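(* Let $\mathcal{M}$ be a von Neumann algebra with predual $\mathcal{M}_*$ and let $x \in \mathcal{M}$ with $\|x\| = 1$. Then $x$ is unitary if and only if $S^x$ spans $\mathcal{M}_*$, where $S^x = \{f \in \mathcal{M}_* : f(x) = \|f\| = 1\}$.
   Context: $\mathcal{M}_*$ denotes the predual of $\mathcal{M}$, identified with the Banach space of weak*-continuous (normal) complex-linear functionals on $\mathcal{M}$. "Spans" refers to the complex linear span (finite linear combinations). *)

theory Defs
  imports "HOL-Analysis.Analysis" "HOL-Library.Function_Algebras"
begin

section \<open>Complex Hilbert spaces\<close>

(* A complex Hilbert space is also a real one, with the real part of the complex inner product as
   real inner product; this supplies the norm and the positive definiteness of cinner.
   The complex inner product is linear in its first argument. *)
class complex_hilbert = real_inner + complete_space +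
  fixes scaleC :: "complex \<Rightarrow> 'a \<Rightarrow> 'a" (infixr "*\<^sub>C" 75)
    and cinner :: "'a \<Rightarrow> 'a \<Rightarrow> complex"
  assumes scaleC_add_right: "a *\<^sub>C (v + w) = a *\<^sub>C v + a *\<^sub>C w"
    and scaleC_add_left: "(a + b) *\<^sub>C v = a *\<^sub>C v + b *\<^sub>C v"
    and scaleC_scaleC: "a *\<^sub>C b *\<^sub>C v = (a * b) *\<^sub>C v"
    and scaleC_of_real: "complex_of_real r *\<^sub>C v = r *\<^sub>R v"
    and cinner_commute: "cinner v w = cnj (cinner w v)"
    and cinner_add_left: "cinner (v + w) u = cinner v u + cinner w u"
    and cinner_scaleC_left: "cinner (a *\<^sub>C v) w = a * cinner v w"
    and Re_cinner: "Re (cinner v w) = inner v w"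
begin

subclass banach ..

end

instantiation complex :: complex_hilbert
begin

definition scaleC_complex :: "complex \<Rightarrow> complex \<Rightarrow> complex"
  where "scaleC_complex a z = a * z"

definition cinner_complex :: "complex \<Rightarrow> complex \<Rightarrow> complex"
  where "cinner_complex z w = z * cnj w"

instance
  by intro_classes
    (simp_all add: scaleC_complex_def cinner_complex_def algebra_simps scaleR_conv_of_real
      inner_complex_def)

end


section \<open>Bounded operators\<close>

(* Operators are plain functions; sums of operators and of functionals are the pointwise ones of
   Function_Algebras, and the operator norm is onorm. *)

definition bounded_clinear :: "('h::complex_hilbert \<Rightarrow> 'h) \<Rightarrow> bool"
  where "bounded_clinear T \<longleftrightarrow> bounded_linear T \<and> (\<forall>a v. T (a *\<^sub>C v) = a *\<^sub>C T v)"

definition cadjoint :: "('h::complex_hilbert \<Rightarrow> 'h) \<Rightarrow> ('h \<Rightarrow> 'h)"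
  where "cadjoint T = (THE S. \<forall>v w. cinner (T v) w = cinner v (S w))"

lemma cinner_right_cancel:
  fixes u u' :: "'h::complex_hilbert"
  assumes "\<And>v. cinner v u = cinner v u'"
  shows "u = u'"
  using assms by (metis Re_cinner vector_eq_ldot)

lemma Im_cinner: "Im (cinner v w) = - inner (\<i> *\<^sub>C v) w"
  by (simp flip: Re_cinner add: cinner_scaleC_left)

lemma real_riesz:
  fixes p :: "'h::complex_hilbert \<Rightarrow> real"
  assumes p: "bounded_linear p"
  shows "\<exists>u. \<forall>v. p v = inner v u"
proof -
  interpret p: bounded_linear p by (rule p)
  define J where "J v = (norm v)\<^sup>2 - 2 * p v" for v
  define m where "m = Inf (range J)"
  obtain K where K: "\<And>v. norm (p v) \<le> norm v * K"
    using p.bounded by blast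
  have lower: "J v \<ge> - K\<^sup>2" for v
  proof -
    have "p v \<le> norm v * K" using K[of v] by simp
    moreover have "0 \<le> (norm v - K)\<^sup>2" by simp
    ultimately show ?thesis by (simp add: J_def power2_eq_square algebra_simps)
  qed
  have bdd: "bdd_below (range J)" using lower by (intro bdd_belowI2) auto
  have m_le: "m \<le> J v" for v unfolding m_def using bdd by (intro cInf_lower) auto
  have "\<exists>v. J v < m + 1 / real (Suc n)" for n
    using cInf_lessD[of "range J" "m + 1 / real (Suc n)"] by (auto simp: m_def)
  then obtain s where s: "\<And>n. J (s n) < m + 1 / real (Suc n)" by metis
  have par: "(norm (v - w))\<^sup>2 \<le> 2 * (J v - m) + 2 * (J w - m)" for v w
  proof -
    define z where "z = (1/2) *\<^sub>R (v + w)"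
    have "2 * J v + 2 * J w - 4 * J z = (norm (v - w))\<^sup>2"
      by (simp add: J_def z_def power2_norm_eq_inner p.scaleR p.add inner_simps inner_commute
          field_simps)
    then show ?thesis using m_le[of z] by (simp add: algebra_simps)
  qed
  have "Cauchy s"
  proof (rule metric_CauchyI)
    fix e :: real assume "e > 0"
    then obtain N where N: "4 / real (Suc N) < e\<^sup>2"
      using reals_Archimedean[of "e\<^sup>2 / 4"] by (auto simp: field_simps)
    have *: "J (s n) - m \<le> 1 / real (Suc N)" if "n \<ge> N" for n
    proof -
      have "1 / real (Suc n) \<le> 1 / real (Suc N)" using that by (simp add: frac_le)
      then show ?thesis using s[of n] by linarith
    qed
    have "dist (s i) (s j) < e" if "i \<ge> N" "j \<ge> N" for i j
    proof -
      have "(norm (s i - s j))\<^sup>2 < e\<^sup>2"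
        using par[of "s i" "s j"] *[OF that(1)] *[OF that(2)] N by simp
      then show ?thesis using \<open>e > 0\<close> power2_less_imp_less[of _ e] by (auto simp: dist_norm)
    qed
    then show "\<exists>N. \<forall>i\<ge>N. \<forall>j\<ge>N. dist (s i) (s j) < e" by blast
  qed
  then obtain u where u: "s \<longlonglongrightarrow> u" using Cauchy_convergent_iff convergent_def by blast
  have "(\<lambda>n. J (s n)) \<longlonglongrightarrow> J u"
    unfolding J_def by (intro tendsto_intros p.tendsto u)
  moreover have "(\<lambda>n. m + 1 / real (Suc n)) \<longlonglongrightarrow> m + 0"
    by (intro tendsto_intros) (rule LIMSEQ_Suc[OF lim_1_over_n])
  ultimately have "J u \<le> m + 0"
    by (rule LIMSEQ_le) (use s less_imp_le in blast)
  then have min: "J u \<le> J v" for v using m_le[of v] by linarith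
  have "p v = inner v u" for v
  proof (cases "v = 0")
    case False
    define d where "d = inner v u - p v"
    define t where "t = - d / (norm v)\<^sup>2"
    have "J (u + t *\<^sub>R v) - J u = t\<^sup>2 * (norm v)\<^sup>2 + 2 * t * d"
      by (simp add: J_def d_def power2_norm_eq_inner p.scaleR p.add inner_simps inner_commute
          distrib_left right_diff_distrib power2_eq_square[of t])
    also have "\<dots> = - (d\<^sup>2 / (norm v)\<^sup>2)"
      using False by (simp add: t_def power2_eq_square field_simps)
    finally have "d\<^sup>2 / (norm v)\<^sup>2 \<le> 0" using min[of "u + t *\<^sub>R v"] by linarith
    then have "d = 0" using False by (simp add: divide_le_0_iff)
    then show ?thesis by (simp add: d_def)
  qed (simp add: p.zero)
  then show ?thesis by blast
qed

lemma cinner_cadjoint: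
  assumes T: "bounded_clinear T"
  shows "cinner (T v) w = cinner v (cadjoint T w)"
proof -
  have bl: "bounded_linear T" and sc: "\<And>a v. T (a *\<^sub>C v) = a *\<^sub>C T v"
    using T by (auto simp: bounded_clinear_def)
  have "\<exists>u. \<forall>v. inner (T v) w = inner v u" for w
    by (rule real_riesz) (intro bounded_linear_compose[OF bounded_linear_inner_left bl])
  then obtain S where S: "\<And>v w. inner (T v) w = inner v (S w)" by metis
  have ex: "cinner (T v) w = cinner v (S w)" for v w
    by (rule complex_eqI) (simp_all add: Im_cinner Re_cinner S flip: sc)
  have "\<exists>!S. \<forall>v w. cinner (T v) w = cinner v (S w)"
  proof (rule ex1I[of _ S])
    show "\<forall>v w. cinner (T v) w = cinner v (S w)" using ex by blast
  next
    fix S' assume S': "\<forall>v w. cinner (T v) w = cinner v (S' w)"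
    show "S' = S"
    proof
      fix w show "S' w = S w"
        by (rule cinner_right_cancel) (simp flip: ex S'[rule_format])
    qed
  qed
  from theI'[OF this] show ?thesis unfolding cadjoint_def by blast
qed

definition unitary :: "('h::complex_hilbert \<Rightarrow> 'h) \<Rightarrow> bool"
  where "unitary T \<longleftrightarrow> bounded_clinear T \<and> cadjoint T \<circ> T = id \<and> T \<circ> cadjoint T = id"


section \<open>Von Neumann algebras\<close>

(* The coarsest topology on X that makes all functions in F continuous (for nonempty F). *)
definition initial_topology :: "'a set \<Rightarrow> ('a \<Rightarrow> complex) set \<Rightarrow> 'a topology"
  where "initial_topology X F = topology_generated_by {{x \<in> X. f x \<in> U} |f U. f \<in> F \<and> open U}"

definition weak_operator_topology :: "('h::complex_hilbert \<Rightarrow> 'h) topology"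
  where "weak_operator_topology =
    initial_topology {T. bounded_clinear T} {\<lambda>T. cinner (T v) w |v w. True}"

(* Also called the sigma-weak topology: the weak* topology of the algebra of all bounded operators
   as the dual of its trace class operators. *)
definition ultraweak_topology :: "('h::complex_hilbert \<Rightarrow> 'h) topology"
  where "ultraweak_topology =
    initial_topology {T. bounded_clinear T}
      {\<lambda>T. \<Sum>n. cinner (T (v n)) (w n) |v w :: nat \<Rightarrow> 'h.
        summable (\<lambda>n. (norm (v n))\<^sup>2) \<and> summable (\<lambda>n. (norm (w n))\<^sup>2)}"

locale von_neumann_algebra =
  fixes M :: "('h::complex_hilbert \<Rightarrow> 'h) set"
  assumes bounded_clinear: "T \<in> M \<Longrightarrow> bounded_clinear T"
    and id_mem: "id \<in> M"
    and add_mem: "S \<in> M \<Longrightarrow> T \<in> M \<Longrightarrow> S + T \<in> M"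
    and scaleC_mem: "T \<in> M \<Longrightarrow> (\<lambda>v. a *\<^sub>C T v) \<in> M"
    and comp_mem: "S \<in> M \<Longrightarrow> T \<in> M \<Longrightarrow> S \<circ> T \<in> M"
    and cadjoint_mem: "T \<in> M \<Longrightarrow> cadjoint T \<in> M"
    and closedin_weak_operator_topology: "closedin weak_operator_topology M"


section \<open>The predual\<close>

(* The restriction of the ultraweak topology to M is the weak* topology of M. A functional on M is
   represented by its extension by 0 outside M, so that functionals which agree on M are equal. *)
definition predual :: "('h::complex_hilbert \<Rightarrow> 'h) set \<Rightarrow> (('h \<Rightarrow> 'h) \<Rightarrow> complex) set"
  where "predual M = {f.
    (\<forall>S\<in>M. \<forall>T\<in>M. f (S + T) = f S + f T) \<and>
    (\<forall>a. \<forall>T\<in>M. f (\<lambda>v. a *\<^sub>C T v) = a * f T) \<and>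
    continuous_map (subtopology ultraweak_topology M) euclidean f \<and>
    (\<forall>T. T \<notin> M \<longrightarrow> f T = 0)}"

definition functional_norm :: "('h::complex_hilbert \<Rightarrow> 'h) set \<Rightarrow> (('h \<Rightarrow> 'h) \<Rightarrow> complex) \<Rightarrow> real"
  where "functional_norm M f = (SUP T\<in>{T \<in> M. onorm T \<le> 1}. cmod (f T))"

definition norming_functionals ::
    "('h::complex_hilbert \<Rightarrow> 'h) set \<Rightarrow> ('h \<Rightarrow> 'h) \<Rightarrow> (('h \<Rightarrow> 'h) \<Rightarrow> complex) set"
  where "norming_functionals M x =
    {f \<in> predual M. f x = complex_of_real (functional_norm M f) \<and> functional_norm M f = 1}"

(* functional.span is the complex linear span. *)
interpretation functional: vector_space "\<lambda>(a::complex) (f :: 'a \<Rightarrow> complex) T. a * f T"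
  by unfold_locales (auto simp: fun_eq_iff algebra_simps)

end

theory Submission
  imports Defs
begin

text \<open>
  An ultraweakly continuous functional is bounded near \<open>0\<close> by finitely many functionals
  \<open>T \<mapsto> \<Sum>n. \<langle>T v\<^sub>n, w\<^sub>n\<rangle>\<close>, hence it is a linear combination of their restrictions. If \<open>x\<close> is
  unitary, polarisation of \<open>\<langle>T x* (x v), w\<rangle>\<close> writes them in terms of the functionals
  \<open>T \<mapsto> \<Sum>n. \<langle>T x* u\<^sub>n, u\<^sub>n\<rangle>\<close>, which are nonnegative multiples of elements of \<open>S\<^sup>x\<close>.
  Conversely, for a contraction \<open>x\<close> and \<open>D = 1 - x* x\<close> or \<open>D = 1 - x x*\<close>, the norm of \<open>x + t D\<close>
  is at most \<open>sqrt (1 + \<bar>t\<bar>\<^sup>2)\<close>. So \<open>\<bar>1 + t f(D)\<bar> \<le> sqrt (1 + \<bar>t\<bar>\<^sup>2)\<close> for all \<open>t\<close> if \<open>f \<in> S\<^sup>x\<close>, which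
  forces \<open>f(D) = 0\<close>. If \<open>S\<^sup>x\<close> spans the predual, then all vector functionals vanish at \<open>D\<close>, so \<open>D = 0\<close>.
\<close>

section \<open>Complex inner products\<close>

lemma cinner_add_right:
  fixes v :: "'h::complex_hilbert"
  shows "cinner v (w + u) = cinner v w + cinner v u"
  by (metis cinner_add_left cinner_commute complex_cnj_add)

lemma cinner_scaleC_right:
  fixes v :: "'h::complex_hilbert"
  shows "cinner v (a *\<^sub>C w) = cnj a * cinner v w"
  by (metis cinner_scaleC_left cinner_commute complex_cnj_mult)

lemma cinner_diff_left:
  fixes v :: "'h::complex_hilbert"
  shows "cinner (v - w) u = cinner v u - cinner w u"
  using cinner_add_left[of "v - w" w u] by simp

lemma cinner_diff_right:
  fixes v :: "'h::complex_hilbert"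
  shows "cinner v (w - u) = cinner v w - cinner v u"
  using cinner_add_right[of v "w - u" u] by simp

lemma cinner_zero_right [simp]: "cinner w (0::'h::complex_hilbert) = 0"
  using cinner_diff_right[of w 0 0] by simp

lemma scaleC_zero_left [simp]: "0 *\<^sub>C v = (0::'h::complex_hilbert)"
  using scaleC_of_real[of 0 v] by simp

lemma scaleC_minus_one: "(-1) *\<^sub>C v = - (v::'h::complex_hilbert)"
  using scaleC_of_real[of "-1" v] by simp

lemma cinner_self: "cinner v v = complex_of_real ((norm (v::'h::complex_hilbert))\<^sup>2)"
proof (rule complex_eqI)
  have "cinner v v = cnj (cinner v v)" by (rule cinner_commute)
  from arg_cong[OF this, of Im] show "Im (cinner v v) = Im (complex_of_real ((norm v)\<^sup>2))" by simp
qed (simp add: Re_cinner power2_norm_eq_inner)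

lemma norm_scaleC: "norm (a *\<^sub>C (v::'h::complex_hilbert)) = cmod a * norm v"
proof -
  have "complex_of_real ((norm (a *\<^sub>C v))\<^sup>2) = a * cnj a * cinner v v"
    by (simp only: cinner_scaleC_left cinner_scaleC_right mult_ac flip: cinner_self)
  also have "\<dots> = complex_of_real ((cmod a * norm v)\<^sup>2)"
    by (simp add: cinner_self power_mult_distrib complex_norm_square flip: of_real_power)
  finally have "(norm (a *\<^sub>C v))\<^sup>2 = (cmod a * norm v)\<^sup>2"
    using of_real_eq_iff by blast
  then show ?thesis by simp
qed

text \<open>Multiplying \<open>v\<close> by the phase \<open>a\<close> rotates
  \<open>cinner v w\<close> onto its modulus. The modulus is then a real inner product, and the real
  Cauchy-Schwarz inequality applies because a phase preserves the norm.\<close>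

lemma cmod_cinner_le: "cmod (cinner v w) \<le> norm v * norm (w::'h::complex_hilbert)"
proof (cases "cinner v w = 0")
  case False
  define a where "a = cnj (cinner v w) / cmod (cinner v w)"
  have a: "cmod a = 1" using False by (simp add: a_def norm_divide)
  have "a * cinner v w = cinner v w * cnj (cinner v w) / cmod (cinner v w)"
    by (simp add: a_def mult.commute)
  also have "\<dots> = complex_of_real ((cmod (cinner v w))\<^sup>2) / cmod (cinner v w)"
    by (simp only: complex_norm_square)
  also have "\<dots> = complex_of_real (cmod (cinner v w))"
    using False by (simp add: power2_eq_square)
  finally have "cmod (cinner v w) = inner (a *\<^sub>C v) w"
    by (metis Re_complex_of_real Re_cinner cinner_scaleC_left)
  also have "\<dots> \<le> norm (a *\<^sub>C v) * norm w" by (rule norm_cauchy_schwarz)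
  finally show ?thesis by (simp add: norm_scaleC a)
qed simp

text \<open>The form at \<open>p + c *\<^sub>C q\<close> is weighted by \<open>c/4\<close>, where
  \<open>c\<close> runs through the fourth roots of unity. The sums of \<open>c\<close> and of
  \<open>c\<^sup>2\<close> vanish, so of the four terms in the expansion only the one with
  \<open>cnj c\<close> survives. Writing \<open>1 *\<^sub>C q\<close> and
  \<open>(-1) *\<^sub>C q\<close> keeps all four summands instances of one pattern in
  \<open>c\<close>.\<close>

lemma cinner_polarization:
  fixes A :: "'h::complex_hilbert \<Rightarrow> 'h"
  assumes add: "\<And>p q. A (p + q) = A p + A q" and scale: "\<And>c p. A (c *\<^sub>C p) = c *\<^sub>C A p"
  shows "1/4 * cinner (A (p + 1 *\<^sub>C q)) (p + 1 *\<^sub>C q)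
      + - (1/4) * cinner (A (p + (-1) *\<^sub>C q)) (p + (-1) *\<^sub>C q)
      + \<i>/4 * cinner (A (p + \<i> *\<^sub>C q)) (p + \<i> *\<^sub>C q)
      + - (\<i>/4) * cinner (A (p + (-\<i>) *\<^sub>C q)) (p + (-\<i>) *\<^sub>C q)
    = cinner (A p) q"
proof -
  have E: "cinner (A (p + c *\<^sub>C q)) (p + c *\<^sub>C q) =
      cinner (A p) p + cnj c * cinner (A p) q + c * cinner (A q) p + (c * cnj c) * cinner (A q) q"
    for c
    by (simp only: add scale cinner_add_left cinner_add_right cinner_scaleC_left
        cinner_scaleC_right algebra_simps)
  show ?thesis unfolding E
    by (rule complex_eqI) (simp_all add: field_simps)
qed

section \<open>Contractions and their adjoints\<close>

lemma adjoint_contraction: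
  fixes y z :: "'h::complex_hilbert \<Rightarrow> 'h"
  assumes adj: "\<And>v w. cinner (y v) w = cinner v (z w)"
    and y: "\<And>v. norm (y v) \<le> norm v"
  shows "norm (z w) \<le> norm w"
proof (cases "z w = 0")
  case False
  \<comment> \<open>The adjoint relation is used at \<open>v = z w\<close>; one factor
    \<open>norm (z w)\<close> then cancels.\<close>
  have "(norm (z w))\<^sup>2 = cmod (cinner (y (z w)) w)"
    by (simp only: adj cinner_self norm_of_real abs_power2)
  also have "\<dots> \<le> norm (z w) * norm w"
    using cmod_cinner_le[of "y (z w)" w] y[of "z w"]
    by (meson mult_right_mono norm_ge_zero order_trans)
  finally show ?thesis using False by (simp add: power2_eq_square)
qed simp

text \<open>This says that the column with entries \<open>y\<close> and \<open>1 - y* y\<close> is a contraction.\<close>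
lemma contraction_column:
  fixes y z :: "'h::complex_hilbert \<Rightarrow> 'h"
  assumes adj: "\<And>v w. cinner (y v) w = cinner v (z w)"
    and y: "\<And>v. norm (y v) \<le> norm v"
  shows "(norm (y w))\<^sup>2 + (norm (w - z (y w)))\<^sup>2 \<le> (norm w)\<^sup>2"
proof -
  have "inner w (z (y w)) = (norm (y w))\<^sup>2"
    using adj[of w "y w"] by (metis Re_cinner power2_norm_eq_inner)
  then have "(norm (w - z (y w)))\<^sup>2 = (norm w)\<^sup>2 - 2 * (norm (y w))\<^sup>2 + (norm (z (y w)))\<^sup>2"
    by (simp add: power2_norm_eq_inner inner_simps inner_commute)
  \<comment> \<open>This restores one of the two subtracted copies of
    \<open>(norm (y w))\<^sup>2\<close>; the other one is the first term of the claim.\<close>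
  moreover have "(norm (z (y w)))\<^sup>2 \<le> (norm (y w))\<^sup>2"
    using adjoint_contraction[OF adj y, of "y w"] by (simp add: power_mono)
  ultimately show ?thesis by linarith
qed

text \<open>Cauchy-Schwarz in the plane for the vector \<open>(1, r)\<close> and the two norms of
  the column. The gap in that inequality is the square \<open>(r * a - b)\<^sup>2\<close>, by
  Lagrange's identity. Later \<open>r\<close> is \<open>cmod t\<close>.\<close>

lemma contraction_column_le:
  fixes y z :: "'h::complex_hilbert \<Rightarrow> 'h"
  assumes adj: "\<And>v w. cinner (y v) w = cinner v (z w)"
    and y: "\<And>v. norm (y v) \<le> norm v"
  shows "norm (y w) + r * norm (w - z (y w)) \<le> sqrt (1 + r\<^sup>2) * norm w"
proof -
  define a b where "a = norm (y w)" and "b = norm (w - z (y w))"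
  have ab: "a\<^sup>2 + b\<^sup>2 \<le> (norm w)\<^sup>2"
    using contraction_column[OF adj y, of w] by (simp add: a_def b_def)
  have "(1 + r\<^sup>2) * (a\<^sup>2 + b\<^sup>2) - (a + r * b)\<^sup>2 = (r * a - b)\<^sup>2"
    by (simp add: power2_eq_square algebra_simps)
  then have "(a + r * b)\<^sup>2 \<le> (1 + r\<^sup>2) * (a\<^sup>2 + b\<^sup>2)"
    by (metis diff_ge_0_iff_ge zero_le_power2)
  also have "\<dots> \<le> (1 + r\<^sup>2) * (norm w)\<^sup>2"
    using ab by (intro mult_left_mono) auto
  also have "\<dots> = (sqrt (1 + r\<^sup>2) * norm w)\<^sup>2"
    by (simp add: power_mult_distrib)
  finally have "a + r * b \<le> sqrt (1 + r\<^sup>2) * norm w"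
    by (rule power2_le_imp_le) simp
  then show ?thesis by (simp add: a_def b_def)
qed


section \<open>Ultraweakly continuous functionals\<close>

definition square_summable :: "(nat \<Rightarrow> 'a::real_normed_vector) \<Rightarrow> bool"
  where "square_summable v \<longleftrightarrow> summable (\<lambda>n. (norm (v n))\<^sup>2)"

text \<open>For square summable \<open>v\<close> and \<open>w\<close> this is the trace of
  \<open>T\<close> times the trace class operator that is the sum of the rank one operators
  \<open>p \<mapsto> cinner p (w n) *\<^sub>C v n\<close>. The value 0 outside \<open>M\<close>
  follows the convention of \<open>predual\<close>.\<close>

definition trace_functional ::
    "('h \<Rightarrow> 'h) set \<Rightarrow> (nat \<Rightarrow> 'h::complex_hilbert) \<Rightarrow> (nat \<Rightarrow> 'h) \<Rightarrow> ('h \<Rightarrow> 'h) \<Rightarrow> complex"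
  where "trace_functional M v w T = (if T \<in> M then \<Sum>n. cinner (T (v n)) (w n) else 0)"

lemma square_summable_add:
  assumes "square_summable v" "square_summable w"
  shows "square_summable (\<lambda>n. v n + w n)"
  unfolding square_summable_def
proof (rule summable_comparison_test')
  show "summable (\<lambda>n. 2 * ((norm (v n))\<^sup>2 + (norm (w n))\<^sup>2))"
    using assms unfolding square_summable_def by (intro summable_mult summable_add)
  fix n
  have "(norm (v n + w n))\<^sup>2 \<le> (norm (v n) + norm (w n))\<^sup>2"
    by (simp add: norm_triangle_ineq power_mono)
  also have "\<dots> \<le> 2 * ((norm (v n))\<^sup>2 + (norm (w n))\<^sup>2)"
    using zero_le_power2[of "norm (v n) - norm (w n)"]
    by (simp add: power2_eq_square algebra_simps)
  finally show "norm ((norm (v n + w n))\<^sup>2) \<le> 2 * ((norm (v n))\<^sup>2 + (norm (w n))\<^sup>2)"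
    by simp
qed

lemma square_summable_bounded:
  assumes "square_summable v" and T: "\<And>n. norm (w n) \<le> K * norm (v n)"
  shows "square_summable w"
  unfolding square_summable_def
proof (rule summable_comparison_test')
  show "summable (\<lambda>n. K\<^sup>2 * (norm (v n))\<^sup>2)"
    using assms unfolding square_summable_def by (intro summable_mult)
  fix n
  have "(norm (w n))\<^sup>2 \<le> (K * norm (v n))\<^sup>2"
    using T[of n] by (simp add: power_mono)
  then show "norm ((norm (w n))\<^sup>2) \<le> K\<^sup>2 * (norm (v n))\<^sup>2"
    by (simp add: power_mult_distrib)
qed

lemma summable_norm_mult:
  assumes "square_summable v" "square_summable w"
  shows "summable (\<lambda>n. norm (v n) * norm (w n))"
proof (rule summable_comparison_test')
  show "summable (\<lambda>n. (norm (v n))\<^sup>2 + (norm (w n))\<^sup>2)"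
    using assms unfolding square_summable_def by (intro summable_add)
  fix n
  have "2 * (norm (v n) * norm (w n)) \<le> (norm (v n))\<^sup>2 + (norm (w n))\<^sup>2"
    using zero_le_power2[of "norm (v n) - norm (w n)"]
    by (simp add: power2_eq_square algebra_simps)
  moreover have "0 \<le> norm (v n) * norm (w n)" by simp
  ultimately show "norm (norm (v n) * norm (w n)) \<le> (norm (v n))\<^sup>2 + (norm (w n))\<^sup>2"
    unfolding real_norm_def by linarith
qed

lemma bounded_clinear_norm_le:
  "bounded_clinear T \<Longrightarrow> norm (T v) \<le> onorm T * norm v"
  unfolding bounded_clinear_def using onorm by blast

lemma norm_cinner_le:
  assumes "bounded_clinear T"
  shows "cmod (cinner (T v) w) \<le> onorm T * (norm v * norm w)"
proof -
  have "cmod (cinner (T v) w) \<le> norm (T v) * norm w" by (rule cmod_cinner_le)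
  also have "\<dots> \<le> (onorm T * norm v) * norm w"
    using bounded_clinear_norm_le[OF assms] by (rule mult_right_mono) simp
  finally show ?thesis by (simp add: mult.assoc)
qed

lemma summable_cmod_cinner:
  assumes "bounded_clinear T" "square_summable v" "square_summable w"
  shows "summable (\<lambda>n. cmod (cinner (T (v n)) (w n)))"
  by (rule summable_comparison_test'[OF
        summable_mult[OF summable_norm_mult[OF assms(2,3)], of "onorm T"]])
     (use norm_cinner_le[OF assms(1)] in simp)

lemmas summable_cinner = summable_norm_cancel[OF summable_cmod_cinner]

lemma cmod_suminf_cinner_le:
  assumes "bounded_clinear T" "square_summable v" "square_summable w"
  shows "cmod (\<Sum>n. cinner (T (v n)) (w n)) \<le> onorm T * (\<Sum>n. norm (v n) * norm (w n))"
proof -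
  have "cmod (\<Sum>n. cinner (T (v n)) (w n)) \<le> (\<Sum>n. cmod (cinner (T (v n)) (w n)))"
    by (rule summable_norm[OF summable_cmod_cinner[OF assms]])
  also have "\<dots> \<le> (\<Sum>n. onorm T * (norm (v n) * norm (w n)))"
    by (intro suminf_le norm_cinner_le assms summable_cmod_cinner summable_mult
        summable_norm_mult)
  also have "\<dots> = onorm T * (\<Sum>n. norm (v n) * norm (w n))"
    by (rule suminf_mult[OF summable_norm_mult[OF assms(2,3)]])
  finally show ?thesis .
qed

text \<open>Induction on the generation of the open set: an intersection takes the union of the two
  finite families and the smaller radius, a subbasic set takes a single function. This is what
  extracts finitely many functionals from ultraweak continuity.\<close>

lemma generate_topology_on_basic_neighbourhood:
  assumes "generate_topology_on {{x \<in> X. f x \<in> U} |f U. f \<in> F \<and> open U} A"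
    and "T \<in> A"
  shows "\<exists>W e. finite W \<and> W \<subseteq> F \<and> 0 < e \<and>
    {S \<in> X. \<forall>f\<in>W. dist (f S) (f T) < (e::real)} \<subseteq> A"
  using assms
proof induction
  case Empty
  then show ?case by simp
next
  case (Int A B)
  obtain W e where We: "finite W" "W \<subseteq> F" "0 < (e::real)"
      "{S \<in> X. \<forall>f\<in>W. dist (f S) (f T) < e} \<subseteq> A"
    using Int by blast
  obtain W' e' where We': "finite W'" "W' \<subseteq> F" "0 < (e'::real)"
      "{S \<in> X. \<forall>f\<in>W'. dist (f S) (f T) < e'} \<subseteq> B"
    using Int by blast
  show ?case
    using We We' by (intro exI[of _ "W \<union> W'"] exI[of _ "min e e'"]) auto
next
  case (UN K)
  then obtain k where k: "k \<in> K" "T \<in> k" by blast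
  then show ?case using UN.IH[OF k] by (meson Union_upper order_trans)
next
  case (Basis s)
  then obtain f U where fU: "s = {x \<in> X. f x \<in> U}" "f \<in> F" "open U" by blast
  then obtain e where "e > 0" "\<forall>y. dist y (f T) < e \<longrightarrow> y \<in> U"
    using Basis.prems open_dist[of U] by blast
  then show ?case using fU by (intro exI[of _ "{f}"] exI[of _ e]) auto
qed


context von_neumann_algebra
begin

section \<open>Linear functionals, trace functionals and the predual\<close>

lemma scaleC_id_mem: "(\<lambda>v. a *\<^sub>C v) \<in> M"
  using scaleC_mem[OF id_mem] by simp

lemma zero_mem: "0 \<in> M"
  using scaleC_id_mem[of 0] by (simp add: zero_fun_def)

lemma diff_mem:
  assumes "S \<in> M" "T \<in> M"
  shows "S - T \<in> M"
proof -
  have "S - T = S + (\<lambda>v. (-1) *\<^sub>C T v)"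
    by (simp add: fun_eq_iff scaleC_minus_one)
  then show ?thesis using add_mem[OF assms(1) scaleC_mem[OF assms(2)]] by (simp only:)
qed

text \<open>The algebraic part of membership in \<open>predual M\<close>, split off because the
  linear dependence argument below involves no topology.\<close>

definition linear_functional :: "(('h \<Rightarrow> 'h) \<Rightarrow> complex) \<Rightarrow> bool"
  where "linear_functional f \<longleftrightarrow>
    (\<forall>S\<in>M. \<forall>T\<in>M. f (S + T) = f S + f T) \<and>
    (\<forall>a. \<forall>T\<in>M. f (\<lambda>v. a *\<^sub>C T v) = a * f T) \<and>
    (\<forall>T. T \<notin> M \<longrightarrow> f T = 0)"

lemma predual_iff:
  "f \<in> predual M \<longleftrightarrow>
    linear_functional f \<and> continuous_map (subtopology ultraweak_topology M) euclidean f"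
  unfolding predual_def linear_functional_def by blast

lemma linear_functional_diff:
  assumes "linear_functional f" "S \<in> M" "T \<in> M"
  shows "f (S - T) = f S - f T"
proof -
  have "f ((S - T) + T) = f (S - T) + f T"
    using assms diff_mem unfolding linear_functional_def by blast
  then show ?thesis by simp
qed

lemma linear_functional_subspace: "functional.subspace (Collect linear_functional)"
  unfolding functional.subspace_def linear_functional_def
  by (auto simp: algebra_simps)

lemma predual_subspace: "functional.subspace (predual M)"
  unfolding functional.subspace_def
proof safe
  show "0 \<in> predual M"
    using functional.subspace_0[OF linear_functional_subspace]
    by (auto simp: predual_iff zero_fun_def)
next
  fix f g assume "f \<in> predual M" "g \<in> predual M"
  then show "f + g \<in> predual M"
    using functional.subspace_add[OF linear_functional_subspace, of f g]
      continuous_map_add[of "subtopology ultraweak_topology M" f g]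
    by (auto simp: predual_iff plus_fun_def)
next
  fix a f assume "f \<in> predual M"
  moreover from this have
    "continuous_map (subtopology ultraweak_topology M) euclidean ((\<lambda>z. a * z) \<circ> f)"
    by (intro continuous_map_compose[where X' = euclidean])
       (auto simp: predual_iff intro!: continuous_intros)
  ultimately show "(\<lambda>T. a * f T) \<in> predual M"
    using functional.subspace_scale[OF linear_functional_subspace, of f a]
    by (auto simp: predual_iff o_def)
qed

lemma linear_functional_trace_functional:
  assumes "square_summable v" "square_summable w"
  shows "linear_functional (trace_functional M v w)"
  unfolding linear_functional_def trace_functional_def
  using assms
  by (auto simp: add_mem scaleC_mem cinner_add_left cinner_scaleC_left summable_cinner
      bounded_clinear suminf_add suminf_mult)

lemma trace_functional_predual:
  assumes "square_summable v" "square_summable w"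
  shows "trace_functional M v w \<in> predual M"
proof -
  let ?F = "{\<lambda>T. \<Sum>n. cinner (T (v n)) (w n) |v w :: nat \<Rightarrow> 'h.
        summable (\<lambda>n. (norm (v n))\<^sup>2) \<and> summable (\<lambda>n. (norm (w n))\<^sup>2)}"
  let ?f = "\<lambda>T. \<Sum>n. cinner (T (v n)) (w n)"
  have f: "?f \<in> ?F" using assms unfolding square_summable_def by blast
  have "continuous_map ultraweak_topology euclidean ?f"
    unfolding continuous_map_def
  proof (intro conjI allI impI)
    fix U :: "complex set" assume "openin euclidean U"
    then have U: "open U" by simp
    \<comment> \<open>The carrier is given only as the union of the subbasis, so it is compared with
      the bounded operators: this inclusion, together with openness of the sets in \<open>b\<close>,
      identifies the preimage of \<open>U\<close> with a subbasic set.\<close>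
    have ts: "topspace ultraweak_topology \<subseteq> {T. bounded_clinear T}"
      unfolding ultraweak_topology_def initial_topology_def topology_generated_by_topspace
      by blast
    have b: "openin ultraweak_topology {T \<in> {T. bounded_clinear T}. ?f T \<in> V}" if "open V" for V
      unfolding ultraweak_topology_def initial_topology_def
      by (rule topology_generated_by_Basis, rule CollectI, intro exI)
         (rule conjI[OF refl conjI[OF f that]])
    have "{T \<in> topspace ultraweak_topology. ?f T \<in> U} = {T \<in> {T. bounded_clinear T}. ?f T \<in> U}"
      using ts openin_subset[OF b[OF U]] by blast
    then show "openin ultraweak_topology {T \<in> topspace ultraweak_topology. ?f T \<in> U}"
      using b[OF U] by simp
  qed simp
  then have "continuous_map (subtopology ultraweak_topology M) euclidean ?f"
    by (rule continuous_map_from_subtopology)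
  then have "continuous_map (subtopology ultraweak_topology M) euclidean (trace_functional M v w)"
    by (rule continuous_map_eq) (simp add: trace_functional_def)
  then show ?thesis
    by (simp add: predual_iff linear_functional_trace_functional[OF assms])
qed

lemma linear_functional_in_span:
  assumes "finite W"
    and "\<And>g. g \<in> W \<Longrightarrow> linear_functional g"
    and "linear_functional f"
    and "\<And>T. T \<in> M \<Longrightarrow> (\<And>g. g \<in> W \<Longrightarrow> g T = 0) \<Longrightarrow> f T = 0"
  shows "f \<in> functional.span W"
  using assms
proof (induction W arbitrary: f rule: finite_induct)
  case empty
  then have "f T = 0" for T by (cases "T \<in> M") (auto simp: linear_functional_def)
  then have "f = 0" by (simp add: fun_eq_iff)
  then show ?case using functional.span_zero by (simp only:)
next
  case (insert h W)
  have mono: "g \<in> functional.span (insert h W)" if "g \<in> functional.span W" for g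
    using that functional.span_mono[of W "insert h W"] by blast
  have h: "linear_functional h" using insert.prems by simp
  show ?case
  proof (cases "\<exists>T\<in>M. (\<forall>g\<in>W. g T = 0) \<and> h T \<noteq> 0")
    case False
    then have "h T = 0" if "T \<in> M" "\<And>g. g \<in> W \<Longrightarrow> g T = 0" for T using that by blast
    then have "f T = 0" if "T \<in> M" "\<And>g. g \<in> W \<Longrightarrow> g T = 0" for T
      using that insert.prems(3)[of T] by (metis insertE)
    then have "f \<in> functional.span W" using insert.prems by (intro insert.IH) auto
    then show ?thesis by (rule mono)
  next
    case True
    then obtain T0 where T0: "T0 \<in> M" "\<And>g. g \<in> W \<Longrightarrow> g T0 = 0" "h T0 \<noteq> 0" by blast
    define c where "c = f T0 / h T0"
    define f' where "f' = f - (\<lambda>T. c * h T)"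
    have "f' \<in> functional.span W"
    proof (rule insert.IH)
      show "linear_functional f'"
        using functional.subspace_diff[OF linear_functional_subspace]
          functional.subspace_scale[OF linear_functional_subspace] insert.prems(2) h
        unfolding f'_def by blast
    next
      fix T assume T: "T \<in> M" "\<And>g. g \<in> W \<Longrightarrow> g T = 0"
      \<comment> \<open>Shifting \<open>T\<close> along \<open>T0\<close> keeps it in the kernel of
        every member of \<open>W\<close> and makes \<open>h\<close> vanish too, so the hypothesis on
        \<open>f\<close> becomes applicable to \<open>S\<close>.\<close>
      define b where "b = h T / h T0"
      define S where "S = T - (\<lambda>v. b *\<^sub>C T0 v)"
      have S: "S \<in> M" by (simp add: S_def T T0 diff_mem scaleC_mem)
      have lin: "k S = k T - b * k T0" if "linear_functional k" for k
        using that linear_functional_diff[OF that T(1) scaleC_mem[OF T0(1)], of b] T0(1)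
        unfolding S_def linear_functional_def by simp
      have "h S = 0" using lin[OF h] T0 by (simp add: b_def)
      moreover have "g S = 0" if "g \<in> W" for g
        using lin[of g] insert.prems(1)[of g] T(2)[OF that] T0(2)[OF that] that by simp
      ultimately have "f S = 0" using insert.prems(3)[OF S] by blast
      then show "f' T = 0"
        using lin[OF insert.prems(2)] by (simp add: f'_def c_def b_def)
    qed (use insert in auto)
    moreover have "(\<lambda>T. c * h T) \<in> functional.span (insert h W)"
      by (intro functional.span_scale functional.span_base) simp
    ultimately have "f' + (\<lambda>T. c * h T) \<in> functional.span (insert h W)"
      by (rule functional.span_add[OF mono])
    then show ?thesis by (simp add: f'_def)
  qed
qed

lemma predual_subset_span:
  "predual M \<subseteq>
    functional.span {trace_functional M v w |v w. square_summable v \<and> square_summable w}"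
proof
  fix f assume f: "f \<in> predual M"
  let ?F = "{\<lambda>T. \<Sum>n. cinner (T (v n)) (w n) |v w :: nat \<Rightarrow> 'h.
        summable (\<lambda>n. (norm (v n))\<^sup>2) \<and> summable (\<lambda>n. (norm (w n))\<^sup>2)}"
  let ?X = "{T :: 'h \<Rightarrow> 'h. bounded_clinear T}"
  have f_lin: "linear_functional f" using f by (simp add: predual_iff)
  have f0: "f 0 = 0" using linear_functional_diff[OF f_lin zero_mem zero_mem] by simp
  have "continuous_map (subtopology ultraweak_topology M) euclidean f"
    using f by (simp add: predual_iff)
  then have "openin (subtopology ultraweak_topology M)
      {T \<in> topspace (subtopology ultraweak_topology M). f T \<in> ball 0 1}"
    by (rule openin_continuous_map_preimage) simp
  then obtain A where A: "openin ultraweak_topology A"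
      "{T \<in> topspace (subtopology ultraweak_topology M). f T \<in> ball 0 1} = A \<inter> M"
    unfolding openin_subtopology by blast
  \<comment> \<open>Zero sequences with the open set \<open>UNIV\<close> give a subbasic set that
    contains every bounded operator.\<close>
  have M_ts: "M \<subseteq> topspace ultraweak_topology"
  proof -
    have "openin ultraweak_topology
        {T \<in> ?X. (\<Sum>n. cinner (T ((\<lambda>_. 0) n)) ((\<lambda>_. 0::'h) (n::nat))) \<in> UNIV}"
      unfolding ultraweak_topology_def initial_topology_def
      by (rule topology_generated_by_Basis, rule CollectI, intro exI conjI)
         (rule refl, rule CollectI, intro exI conjI, rule refl, simp_all)
    then show ?thesis using bounded_clinear openin_subset by fastforce
  qed
  have "0 \<in> A" using A(2) M_ts zero_mem f0 by auto
  moreover have "generate_topology_on {{x \<in> ?X. f x \<in> U} |f U. f \<in> ?F \<and> open U} A"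
    using A(1) unfolding ultraweak_topology_def initial_topology_def
      openin_topology_generated_by_iff .
  ultimately have "\<exists>W e. finite W \<and> W \<subseteq> ?F \<and> 0 < (e::real) \<and>
      {S \<in> ?X. \<forall>g\<in>W. dist (g S) (g 0) < e} \<subseteq> A"
    by (intro generate_topology_on_basic_neighbourhood)
  then obtain W e where W: "finite W" "W \<subseteq> ?F" and e: "0 < (e::real)"
    and sub: "{S \<in> ?X. \<forall>g\<in>W. dist (g S) (g 0) < e} \<subseteq> A"
    by blast
  \<comment> \<open>Cutting the functionals off outside \<open>M\<close> turns them into trace
    functionals and brings them under \<open>linear_functional\<close>.\<close>
  define W' where "W' = (\<lambda>g T. if T \<in> M then g T else 0) ` W"
  have W': "W' \<subseteq> {trace_functional M v w |v w. square_summable v \<and> square_summable w}"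
  proof
    fix g' assume "g' \<in> W'"
    then obtain g where g: "g \<in> W" "g' = (\<lambda>T. if T \<in> M then g T else 0)"
      unfolding W'_def by blast
    then obtain v w :: "nat \<Rightarrow> 'h" where "g = (\<lambda>T. \<Sum>n. cinner (T (v n)) (w n))"
        "square_summable v" "square_summable w"
      using W unfolding square_summable_def by blast
    then show "g' \<in> {trace_functional M v w |v w. square_summable v \<and> square_summable w}"
      using g by (auto simp: trace_functional_def fun_eq_iff)
  qed
  have W'_lin: "linear_functional g" if "g \<in> W'" for g
    using W' that linear_functional_trace_functional by blast
  have "f \<in> functional.span W'"
  proof (rule linear_functional_in_span)
    show "finite W'" using W by (simp add: W'_def)
  next
    fix T assume T: "T \<in> M" "\<And>g. g \<in> W' \<Longrightarrow> g T = 0"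
    \<comment> \<open>The common kernel of \<open>W'\<close> is closed under scalars and lies in the
      neighbourhood \<open>A\<close> of 0, where \<open>f\<close> has modulus below 1. Bounded
      values on all multiples of \<open>T\<close> force \<open>f T = 0\<close>, as the scalar
      \<open>1 / f T\<close> shows.\<close>
    have "cmod (a * f T) < 1" for a
    proof -
      have aT: "(\<lambda>v. a *\<^sub>C T v) \<in> M" using T(1) by (rule scaleC_mem)
      have eq: "g (\<lambda>v. a *\<^sub>C T v) = g 0" if "g \<in> W" for g
      proof -
        define g' where "g' = (\<lambda>T. if T \<in> M then g T else 0)"
        have g': "g' \<in> W'" using that by (auto simp: W'_def g'_def)
        have "g' (\<lambda>v. a *\<^sub>C T v) = 0"
          using W'_lin[OF g'] T g' unfolding linear_functional_def by simp
        moreover have "g' 0 = 0"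
          using linear_functional_diff[OF W'_lin[OF g'] zero_mem zero_mem] by simp
        ultimately show ?thesis using aT zero_mem by (simp add: g'_def)
      qed
      have "dist (g (\<lambda>v. a *\<^sub>C T v)) (g 0) < e" if "g \<in> W" for g
        using e by (simp only: eq[OF that] dist_self)
      then have "(\<lambda>v. a *\<^sub>C T v) \<in> A"
        using bounded_clinear[OF aT] by (auto intro!: subsetD[OF sub])
      then have "f (\<lambda>v. a *\<^sub>C T v) \<in> ball 0 1" using aT A(2) by blast
      then show ?thesis using f_lin T(1) by (simp add: linear_functional_def)
    qed
    from this[of "1 / f T"] show "f T = 0" by (cases "f T = 0") auto
  qed (use f_lin W'_lin in auto)
  then show "f \<in> functional.span {trace_functional M v w |v w. square_summable v \<and> square_summable w}"
    using functional.span_mono[OF W'] by blast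
qed

section \<open>Boundedness of normal functionals and the norm of norming functionals\<close>

lemma predual_bounded:
  assumes "f \<in> predual M"
  shows "\<exists>K. \<forall>T\<in>M. cmod (f T) \<le> K * onorm T"
proof -
  have "f \<in> functional.span {trace_functional M v w |v w. square_summable v \<and> square_summable w}"
    using assms predual_subset_span by blast
  then show ?thesis
  proof (induction rule: functional.span_induct_alt)
    case base
    show ?case by (rule exI[of _ 0]) simp
  next
    case (step c g h)
    then obtain K where K: "\<And>T. T \<in> M \<Longrightarrow> cmod (h T) \<le> K * onorm T" by blast
    obtain v w where vw: "g = trace_functional M v w" "square_summable v" "square_summable w"
      using step by blast
    define L where "L = (\<Sum>n. norm (v n) * norm (w n))"
    have "cmod (((\<lambda>T. c * g T) + h) T) \<le> (cmod c * L + K) * onorm T" if "T \<in> M" for T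
    proof -
      have "cmod (g T) \<le> onorm T * L"
        using cmod_suminf_cinner_le[OF bounded_clinear[OF that] vw(2,3)] that
        by (simp add: vw trace_functional_def L_def)
      then have "cmod c * cmod (g T) \<le> cmod c * (onorm T * L)"
        by (intro mult_left_mono) auto
      moreover have "cmod (((\<lambda>T. c * g T) + h) T) \<le> cmod c * cmod (g T) + cmod (h T)"
        by (simp add: norm_mult [symmetric] norm_triangle_ineq)
      ultimately show ?thesis using K[OF that] by (simp add: algebra_simps)
    qed
    then show ?case by blast
  qed
qed

lemma norming_functional_le:
  assumes f: "f \<in> norming_functionals M x" and T: "T \<in> M"
  shows "cmod (f T) \<le> onorm T"
proof -
  have fp: "f \<in> predual M" and f1: "functional_norm M f = 1"
    using f by (auto simp: norming_functionals_def)
  obtain K where K: "\<And>T. T \<in> M \<Longrightarrow> cmod (f T) \<le> K * onorm T"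
    using predual_bounded[OF fp] by blast
  have "cmod (f S) \<le> \<bar>K\<bar>" if "S \<in> M" "onorm S \<le> 1" for S
  proof -
    have "0 \<le> onorm S"
      using bounded_clinear[OF that(1)] onorm_pos_le unfolding bounded_clinear_def by blast
    then have "K * onorm S \<le> \<bar>K\<bar> * 1"
      using that by (intro mult_mono) auto
    then show ?thesis using K[OF that(1)] by simp
  qed
  \<comment> \<open>Only for a set bounded above does the \<open>SUP\<close> in
    \<open>functional_norm\<close> dominate the individual values.\<close>
  then have "bdd_above ((\<lambda>T. cmod (f T)) ` {T \<in> M. onorm T \<le> 1})"
    by (intro bdd_aboveI2) auto
  then have le1: "cmod (f S) \<le> 1" if "S \<in> M" "onorm S \<le> 1" for S
    using that f1 cSUP_upper[of S "{T \<in> M. onorm T \<le> 1}" "\<lambda>T. cmod (f T)"]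
    unfolding functional_norm_def by simp
  show ?thesis
  \<comment> \<open>Norm 0 is separated because \<open>T\<close> is about to be divided by its norm;
    in that case the bound with \<open>K\<close> already gives \<open>f T = 0\<close>.\<close>
  proof (cases "onorm T = 0")
    case True
    then show ?thesis using K[OF T] by simp
  next
    case False
    then have pos: "0 < onorm T"
      using bounded_clinear[OF T] onorm_pos_le unfolding bounded_clinear_def
      by (metis order_less_le)
    define a where "a = complex_of_real (1 / onorm T)"
    have a: "cmod a = 1 / onorm T" using pos by (simp add: a_def norm_divide)
    have "onorm (\<lambda>v. a *\<^sub>C T v) \<le> 1"
    proof (rule onorm_bound)
      fix v
      show "norm (a *\<^sub>C T v) \<le> 1 * norm v"
        using bounded_clinear_norm_le[OF bounded_clinear[OF T], of v] pos
        by (simp add: norm_scaleC a field_simps)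
    qed simp
    then have "cmod (f (\<lambda>v. a *\<^sub>C T v)) \<le> 1" using le1 scaleC_mem[OF T] by blast
    moreover have "f (\<lambda>v. a *\<^sub>C T v) = a * f T"
      using fp T by (simp add: predual_def)
    ultimately show ?thesis using pos by (simp add: norm_mult a field_simps)
  qed
qed

text \<open>The choice \<open>t = cnj (f D)\<close> gives \<open>(1 + \<bar>f D\<bar>\<^sup>2)\<^sup>2 \<le> 1 + \<bar>f D\<bar>\<^sup>2\<close>.\<close>
lemma norming_functional_eq_0:
  assumes f: "f \<in> norming_functionals M x" and x: "x \<in> M" and D: "D \<in> M"
    and le: "\<And>t. onorm (x + (\<lambda>v. t *\<^sub>C D v)) \<le> sqrt (1 + (cmod t)\<^sup>2)"
  shows "f D = 0"
proof -
  define t where "t = cnj (f D)"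
  define d where "d = (cmod (f D))\<^sup>2"
  have lin: "linear_functional f" and fx: "f x = 1"
    using f by (auto simp: norming_functionals_def predual_iff)
  have "f (x + (\<lambda>v. t *\<^sub>C D v)) = 1 + t * f D"
    using lin x D scaleC_mem[OF D] fx unfolding linear_functional_def by simp
  also have "\<dots> = complex_of_real (1 + d)"
    by (simp add: t_def d_def complex_norm_square mult.commute flip: of_real_power)
  finally have "1 + d \<le> cmod (f (x + (\<lambda>v. t *\<^sub>C D v)))"
    by (metis norm_of_real abs_ge_self)
  also have "\<dots> \<le> sqrt (1 + d)"
    using norming_functional_le[OF f add_mem[OF x scaleC_mem[OF D]], of t] le[of t]
    by (simp add: t_def d_def)
  finally have "(1 + d)\<^sup>2 \<le> 1 + d"
    using real_sqrt_pow2[of "1 + d"] power_mono[of "1 + d" "sqrt (1 + d)" 2]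
    by (simp add: d_def)
  moreover have "0 \<le> d" by (simp add: d_def)
  ultimately have "d = 0"
    using mult_le_cancel_left_pos[of "1 + d" "1 + d" 1] by (simp add: power2_eq_square)
  then show ?thesis by (simp add: d_def)
qed

section \<open>Spanning forces unitarity\<close>

lemma predual_separates:
  assumes D: "D \<in> M" and "\<And>f. f \<in> predual M \<Longrightarrow> f D = 0"
  shows "D v = 0"
proof -
  \<comment> \<open>Sequences supported at index 0 turn a trace functional into the vector
    functional of \<open>v\<close> and \<open>D v\<close>, whose value at \<open>D\<close> is
    \<open>(norm (D v))\<^sup>2\<close>.\<close>
  define a b :: "nat \<Rightarrow> 'h"
    where "a n = (if n = 0 then v else 0)" and "b n = (if n = 0 then D v else 0)" for n
  have "square_summable a" "square_summable b"
    unfolding square_summable_def a_def b_def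
    by (intro summable_finite[of "{0}"]; simp)+
  then have "trace_functional M a b D = 0"
    using assms(2) trace_functional_predual by blast
  moreover have "(\<Sum>n. cinner (D (a n)) (b n)) = (\<Sum>n\<in>{0}. cinner (D (a n)) (b n))"
    by (rule suminf_finite) (auto simp: b_def)
  ultimately have "cinner (D v) (D v) = 0"
    using D by (simp add: trace_functional_def a_def b_def)
  then show ?thesis by (simp add: cinner_self)
qed

lemma unitary_if_span_norming_functionals:
  assumes x: "x \<in> M" "onorm x \<le> 1"
    and span: "functional.span (norming_functionals M x) = predual M"
  shows "unitary x"
proof -
  define y where "y = cadjoint x"
  have bx: "bounded_clinear x" using bounded_clinear x by blast
  have y: "y \<in> M" using x cadjoint_mem by (simp add: y_def)
  have adj: "cinner (x v) w = cinner v (y w)" for v w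
    using cinner_cadjoint[OF bx] by (simp add: y_def)
  have adj': "cinner (y v) w = cinner v (x w)" for v w
    by (metis adj cinner_commute)
  have nx: "norm (x v) \<le> norm v" for v
    using bounded_clinear_norm_le[OF bx, of v] x(2)
      mult_right_mono[OF x(2), of "norm v"] by simp
  have ny: "norm (y v) \<le> norm v" for v
    by (rule adjoint_contraction[OF adj nx])
  \<comment> \<open>The spanning hypothesis enters here: vanishing at \<open>D\<close> passes from
    the norming functionals to their linear combinations, hence to the whole predual, which
    separates points.\<close>
  have zero: "D v = 0"
    if D: "D \<in> M" and le: "\<And>t. onorm (x + (\<lambda>v. t *\<^sub>C D v)) \<le> sqrt (1 + (cmod t)\<^sup>2)" for D v
  proof (rule predual_separates[OF D])
    fix f assume "f \<in> predual M"
    then have "f \<in> functional.span (norming_functionals M x)" by (simp add: span)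
    then show "f D = 0"
      by (induction rule: functional.span_induct_alt)
         (simp_all add: norming_functional_eq_0[OF _ x(1) D le])
  qed
  have "(id - (y \<circ> x)) v = 0" for v
  proof (rule zero[of "id - (y \<circ> x)"])
    fix t :: complex
    show "onorm (x + (\<lambda>v. t *\<^sub>C (id - (y \<circ> x)) v)) \<le> sqrt (1 + (cmod t)\<^sup>2)"
    proof (rule onorm_bound)
      fix v
      have "norm (x v + t *\<^sub>C (v - y (x v))) \<le> norm (x v) + cmod t * norm (v - y (x v))"
        using norm_triangle_ineq[of "x v" "t *\<^sub>C (v - y (x v))"] by (simp add: norm_scaleC)
      also have "\<dots> \<le> sqrt (1 + (cmod t)\<^sup>2) * norm v"
        by (rule contraction_column_le[OF adj nx])
      finally show "norm ((x + (\<lambda>v. t *\<^sub>C (id - (y \<circ> x)) v)) v) \<le> sqrt (1 + (cmod t)\<^sup>2) * norm v"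
        by simp
    qed simp
  qed (intro diff_mem id_mem comp_mem x y)
  moreover have "(id - (x \<circ> y)) v = 0" for v
  proof (rule zero[of "id - (x \<circ> y)"])
    fix t :: complex
    show "onorm (x + (\<lambda>v. t *\<^sub>C (id - (x \<circ> y)) v)) \<le> sqrt (1 + (cmod t)\<^sup>2)"
    proof (rule onorm_bound)
      fix v
      \<comment> \<open>The column estimate for \<open>y\<close> controls the adjoint
        \<open>y + cnj t (1 - x y)\<close> of the operator in question. Pairing the image
        \<open>w\<close> of \<open>v\<close> with itself moves the operator across the inner product
        to this adjoint; a factor \<open>norm w\<close> cancels at the end.\<close>
      define w where "w = x v + t *\<^sub>C (v - x (y v))"
      have "cinner w w = cinner v (y w) + t * cinner v (w - x (y w))"
        \<comment> \<open>Only the first argument is expanded; the second has to stay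
          \<open>w\<close>.\<close>
        unfolding w_def[THEN arg_cong[where f = "\<lambda>u. cinner u w"]]
        by (simp add: cinner_add_left cinner_scaleC_left cinner_diff_left cinner_diff_right adj adj')
      then have "(norm w)\<^sup>2 = cmod (cinner v (y w) + t * cinner v (w - x (y w)))"
        by (metis cinner_self norm_of_real abs_power2)
      also have "\<dots> \<le> cmod (cinner v (y w)) + cmod t * cmod (cinner v (w - x (y w)))"
        by (metis norm_triangle_ineq norm_mult)
      also have "\<dots> \<le> norm v * norm (y w) + cmod t * (norm v * norm (w - x (y w)))"
        by (intro add_mono mult_left_mono cmod_cinner_le) simp
      also have "\<dots> = norm v * (norm (y w) + cmod t * norm (w - x (y w)))"
        by (simp add: algebra_simps)
      also have "\<dots> \<le> norm v * (sqrt (1 + (cmod t)\<^sup>2) * norm w)"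
        by (intro mult_left_mono contraction_column_le[OF adj' ny]) simp
      finally have "norm w * norm w \<le> (sqrt (1 + (cmod t)\<^sup>2) * norm v) * norm w"
        by (simp add: power2_eq_square mult_ac)
      then have "norm w \<le> sqrt (1 + (cmod t)\<^sup>2) * norm v"
        by (cases "w = 0") auto
      then show "norm ((x + (\<lambda>v. t *\<^sub>C (id - (x \<circ> y)) v)) v) \<le> sqrt (1 + (cmod t)\<^sup>2) * norm v"
        by (simp add: w_def)
    qed simp
  qed (intro diff_mem id_mem comp_mem x y)
  ultimately show ?thesis
    using bx unfolding unitary_def y_def by (auto simp: fun_eq_iff)
qed

section \<open>Unitarity forces spanning\<close>

lemma unitary_norm_cadjoint:
  assumes "unitary x"
  shows "norm (cadjoint x v) = norm v"
proof -
  have "cinner (cadjoint x v) (cadjoint x v) = cinner (x (cadjoint x v)) v"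
    using assms cinner_cadjoint[of x "cadjoint x v" v] by (simp add: unitary_def)
  also have "x (cadjoint x v) = v"
    using assms unfolding unitary_def by (metis comp_apply id_apply)
  finally have "(norm (cadjoint x v))\<^sup>2 = (norm v)\<^sup>2"
    unfolding cinner_self of_real_eq_iff .
  then show ?thesis by simp
qed

text \<open>Since \<open>cadjoint x\<close> is isometric, this functional is bounded by
  \<open>s\<close>, the sum of the squared norms of the \<open>u n\<close>; since
  \<open>x \<circ> cadjoint x = id\<close>, its value at \<open>x\<close> is exactly
  \<open>s\<close>. Dividing by \<open>s\<close> therefore gives a norming functional.\<close>

lemma trace_functional_in_span_norming:
  assumes x: "x \<in> M" "onorm x \<le> 1" "unitary x" and u: "square_summable u"
  shows "trace_functional M (cadjoint x \<circ> u) u \<in> functional.span (norming_functionals M x)"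
proof -
  define h where "h = trace_functional M (cadjoint x \<circ> u) u"
  define s where "s = (\<Sum>n. (norm (u n))\<^sup>2)"
  have xu: "square_summable (cadjoint x \<circ> u)"
    using u unitary_norm_cadjoint[OF x(3)] by (simp add: square_summable_def)
  have h: "h \<in> predual M" unfolding h_def by (rule trace_functional_predual[OF xu u])
  have hT: "cmod (h T) \<le> onorm T * s" if "T \<in> M" for T
    using cmod_suminf_cinner_le[OF bounded_clinear[OF that] xu u] that
    by (simp add: h_def trace_functional_def s_def unitary_norm_cadjoint[OF x(3)] power2_eq_square)
  have xx: "x (cadjoint x v) = v" for v
    using x(3) unfolding unitary_def by (metis comp_apply id_apply)
  have hx: "h x = complex_of_real s"
    using x(1) u by (simp add: h_def trace_functional_def s_def xx cinner_self suminf_of_real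
        square_summable_def flip: of_real_power)
  have s0: "0 \<le> s" using u unfolding s_def square_summable_def by (intro suminf_nonneg) auto
  have "h \<in> functional.span (norming_functionals M x)"
  proof (cases "s = 0")
    \<comment> \<open>Normalising is impossible here, but the bound by \<open>onorm T * s\<close>
      makes the functional 0.\<close>
    case True
    then have "h T = 0" for T
      using hT[of T] by (cases "T \<in> M") (auto simp: h_def trace_functional_def)
    then have "h = 0" by (simp add: fun_eq_iff)
    then show ?thesis by (simp add: functional.span_zero)
  next
    case False
    define k where "k = (\<lambda>T. complex_of_real (1 / s) * h T)"
    have kp: "k \<in> predual M"
      unfolding k_def by (rule functional.subspace_scale[OF predual_subspace h])
    have kx: "k x = 1" using False by (simp add: k_def hx)
    have "functional_norm M k = 1"
      unfolding functional_norm_def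
    proof (rule cSup_eq_maximum)
      show "1 \<in> (\<lambda>T. cmod (k T)) ` {T \<in> M. onorm T \<le> 1}"
        using x kx by (intro image_eqI[of _ _ x]) auto
    next
      fix r assume "r \<in> (\<lambda>T. cmod (k T)) ` {T \<in> M. onorm T \<le> 1}"
      then obtain T where T: "T \<in> M" "onorm T \<le> 1" "r = cmod (k T)" by blast
      have "cmod (h T) \<le> 1 * s"
        using hT[OF T(1)] mult_right_mono[OF T(2) s0] by linarith
      then show "r \<le> 1"
        using T False s0 by (simp add: k_def norm_mult norm_divide divide_le_eq)
    qed
    then have "k \<in> norming_functionals M x"
      using kp kx by (simp add: norming_functionals_def)
    then have "(\<lambda>T. complex_of_real s * k T) \<in> functional.span (norming_functionals M x)"
      by (intro functional.span_scale functional.span_base)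
    then show ?thesis using False by (simp add: k_def)
  qed
  then show ?thesis by (simp add: h_def)
qed

lemma span_norming_functionals_if_unitary:
  assumes x: "x \<in> M" "onorm x \<le> 1" "unitary x"
  shows "functional.span (norming_functionals M x) = predual M"
proof
  show "functional.span (norming_functionals M x) \<subseteq> predual M"
    by (rule functional.span_minimal[OF _ predual_subspace]) (auto simp: norming_functionals_def)
next
  let ?N = "functional.span (norming_functionals M x)"
  have "trace_functional M v w \<in> ?N" if v: "square_summable v" and w: "square_summable w" for v w
  proof -
    \<comment> \<open>Polarisation will be applied to \<open>A = T \<circ> cadjoint x\<close> at the
      pair \<open>x (v n)\<close>, \<open>w n\<close>. The \<open>x\<close> in front of
      \<open>v n\<close> is undone by the adjoint inside \<open>A\<close>, which recovers
      \<open>cinner (T (v n)) (w n)\<close>.\<close>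
    define u where "u c n = x (v n) + c *\<^sub>C w n" for c n
    define g where "g c = trace_functional M (cadjoint x \<circ> u c) (u c)" for c
    have xv: "square_summable (\<lambda>n. x (v n))"
      using v bounded_clinear_norm_le[OF bounded_clinear[OF x(1)]] by (rule square_summable_bounded)
    have u: "square_summable (u c)" for c
      unfolding u_def
      by (intro square_summable_add xv square_summable_bounded[OF w, of _ "cmod c"])
         (simp add: norm_scaleC)
    have cu: "square_summable (cadjoint x \<circ> u c)" for c
      using u[of c] unitary_norm_cadjoint[OF x(3)] by (simp add: square_summable_def)
    have gN: "(\<lambda>T. a * g c T) \<in> ?N" for a c
      unfolding g_def by (intro functional.span_scale trace_functional_in_span_norming x u)
    have "trace_functional M v w = (\<lambda>T. 1/4 * g 1 T) + (\<lambda>T. - (1/4) * g (-1) T)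
        + (\<lambda>T. \<i>/4 * g \<i> T) + (\<lambda>T. - (\<i>/4) * g (-\<i>) T)"
    proof
      fix T
      show "trace_functional M v w T = ((\<lambda>T. 1/4 * g 1 T) + (\<lambda>T. - (1/4) * g (-1) T)
        + (\<lambda>T. \<i>/4 * g \<i> T) + (\<lambda>T. - (\<i>/4) * g (-\<i>) T)) T"
      proof (cases "T \<in> M")
        case True
        define A where "A = T \<circ> cadjoint x"
        have bA: "bounded_clinear A"
          unfolding A_def using True x by (intro bounded_clinear comp_mem cadjoint_mem)
        have Aadd: "A (p + q) = A p + A q" for p q
          using bA by (simp add: bounded_clinear_def linear_simps)
        have Asc: "A (a *\<^sub>C p) = a *\<^sub>C A p" for a p
          using bA by (simp add: bounded_clinear_def)
        have Ax: "A (x p) = T p" for p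
          using x(3) unfolding unitary_def A_def by (metis comp_apply id_apply)
        have s: "(\<lambda>n. cinner (A (u c n)) (u c n)) sums g c T" for c
          using summable_sums[OF summable_cinner[OF bounded_clinear[OF True] cu u]] True
          by (simp add: g_def trace_functional_def A_def)
        \<comment> \<open>The four series converge separately, so the termwise polarisation identity
          may be summed over \<open>n\<close>.\<close>
        have "(\<lambda>n. 1/4 * cinner (A (u 1 n)) (u 1 n) + - (1/4) * cinner (A (u (-1) n)) (u (-1) n)
            + \<i>/4 * cinner (A (u \<i> n)) (u \<i> n) + - (\<i>/4) * cinner (A (u (-\<i>) n)) (u (-\<i>) n))
          sums (1/4 * g 1 T + - (1/4) * g (-1) T + \<i>/4 * g \<i> T + - (\<i>/4) * g (-\<i>) T)"
          by (intro sums_add sums_mult s)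
        also have "(\<lambda>n. 1/4 * cinner (A (u 1 n)) (u 1 n)
            + - (1/4) * cinner (A (u (-1) n)) (u (-1) n)
            + \<i>/4 * cinner (A (u \<i> n)) (u \<i> n) + - (\<i>/4) * cinner (A (u (-\<i>) n)) (u (-\<i>) n))
          = (\<lambda>n. cinner (T (v n)) (w n))"
          unfolding u_def by (simp only: cinner_polarization[OF Aadd Asc] Ax)
        finally show ?thesis
          using True by (simp add: trace_functional_def sums_iff)
      qed (simp add: trace_functional_def g_def)
    qed
    then show ?thesis by (simp only:) (intro functional.span_add gN)
  qed
  then have "{trace_functional M v w |v w. square_summable v \<and> square_summable w} \<subseteq> ?N"
    by blast
  then have "functional.span {trace_functional M v w |v w. square_summable v \<and> square_summable w}
      \<subseteq> ?N"
    by (rule functional.span_minimal) (rule functional.subspace_span)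
  then show "predual M \<subseteq> ?N" using predual_subset_span by blast
qed

end

theorem theorem3:
  fixes M :: "('h::complex_hilbert \<Rightarrow> 'h) set" and x :: "'h \<Rightarrow> 'h"
  assumes "von_neumann_algebra M"
    and "x \<in> M"
    and "onorm x = 1"
  shows "unitary x \<longleftrightarrow> functional.span (norming_functionals M x) = predual M"
proof -
  interpret von_neumann_algebra M by (rule assms)
  show ?thesis
    using assms unitary_if_span_norming_functionals span_norming_functionals_if_unitary by auto
qed

end
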